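(* Let $(M,\varphi,\xi,\eta,g)$ be a $(2n+1)$-dimensional almost contact B-metric manifold and let $\vartheta$ be a vector field on $M$ that is vertical with a constant $k=\eta(\vartheta)$ (i.e. $\vartheta=k\,\xi$ with $k$ a nonzero constant) and torse-forming with a function $f$ as conformal scalar. Moreover, let $a,b,c,\lambda,\mu,\nu$ be functions on $M$ that satisfy the following equalities: $$a+\lambda+f=0,\qquad b+\mu=0,\qquad c+\nu-f=0,$$ $$\lambda+\mu+\nu=-a-b-c=\frac{2n}{k^2}\left\{k\,\mathrm{d}f(\xi)+f^2\right\}.$$ Then $M$ admits an almost Ricci-like soliton with potential $\vartheta$ and functions $(\lambda,\mu,\nu)$ if and only if $M$ is almost Einstein-like with functions $(a,b,c)$.
   Context: An almost contact B-metric manifold $(M,\varphi,\xi,\eta,g)$ is a smooth manifold $M$ of dimension $2n+1$ ($n\ge 1$) with an endomorphism $\varphi$ of $TM$, a vector field $\xi$ (the Reeb vector field), a 1-form $\eta$, and a pseudo-Riemannian metric $g$ of signature $(n+1,n)$ such that $$\varphi\xi=0,\quad \varphi^2=-\mathrm{id}+\eta\otimes\xi,\quad \eta\circ\varphi=0,\quad \eta(\xi)=1,\quad g(\varphi x,\varphi y)=-g(x,y)+\eta(x)\eta(y)$$ for all $x,y$. The associated metric is $\tilde g(x,y)=g(x,\varphi y)+\eta(x)\eta(y)$. $\nabla$ is the Levi-Civita connection of $g$, $\rho$ is the Ricci tensor of $g$ (with $R(x,y)z=\nabla_x\nabla_yz-\nabla_y\nabla_xz-\nabla_{[x,y]}z$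 and $\rho(y,z)=\mathrm{tr}\,(x\mapsto R(x,y)z)$), and $\mathcal L$ is the Lie derivative. A vector field $\vartheta$ is torse-forming if $\nabla_x\vartheta=f\,x+\gamma(x)\vartheta$ for all $x$, where $f$ is a differentiable function (the conformal scalar) and $\gamma$ is a 1-form (the generating form). The trivial case $f=0$ (identically) is excluded. $M$ admits an almost Ricci-like soliton with potential $\vartheta$ and functions $(\lambda,\mu,\nu)$ on $M$ if $$\tfrac12\mathcal L_\vartheta g+\rho+\lambda\,g+\mu\,\tilde g+\nu\,\eta\otimes\eta=0.$$ $M$ is almost Einstein-like with functions $(a,b,c)$ on $M$ if $\rho=a\,g+b\,\tilde g+c\,\eta\otimes\eta$. *)

theory Defs
  imports "HOL-Analysis.Analysis"
begin

section \<open>Smooth manifolds\<close>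

text \<open>\<open>Ck_on k S f\<close>: \<open>f\<close> is of class \<open>C^k\<close> on the open set \<open>S\<close>.\<close>

fun Ck_on :: "nat \<Rightarrow> 'a::euclidean_space set \<Rightarrow> ('a \<Rightarrow> 'b::real_normed_vector) \<Rightarrow> bool" where
  "Ck_on 0 S f \<longleftrightarrow> continuous_on S f"
| "Ck_on (Suc k) S f \<longleftrightarrow>
     (\<forall>x\<in>S. f differentiable (at x)) \<and> (\<forall>v. Ck_on k S (\<lambda>x. frechet_derivative f (at x) v))"

definition smooth_on :: "'a::euclidean_space set \<Rightarrow> ('a \<Rightarrow> 'b::real_normed_vector) \<Rightarrow> bool" where
  "smooth_on S f \<longleftrightarrow> (\<forall>k. Ck_on k S f)"

text \<open>The underlying set of the manifold is the whole topological type \<open>'m\<close>, its dimension is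
  \<open>CARD('d)\<close>. A chart is a pair of its domain and its coordinate map; values of the
  coordinate map outside the domain are irrelevant.\<close>

type_synonym ('m, 'd) chart = "'m set \<times> ('m \<Rightarrow> real ^ 'd)"
type_synonym ('m, 'd) vfield = "'m \<Rightarrow> real ^ 'd"
type_synonym ('m, 'd) covector_field = "'m \<Rightarrow> real ^ 'd \<Rightarrow> real"
type_synonym ('m, 'd) endo_field = "'m \<Rightarrow> real ^ 'd \<Rightarrow> real ^ 'd"
type_synonym ('m, 'd) bilinear_field = "'m \<Rightarrow> real ^ 'd \<Rightarrow> real ^ 'd \<Rightarrow> real"

definition chart_inv :: "('m, 'd) chart \<Rightarrow> real ^ 'd \<Rightarrow> 'm" where
  "chart_inv c = inv_into (fst c) (snd c)"

definition chart_image :: "('m, 'd) chart \<Rightarrow> (real ^ 'd) set" where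
  "chart_image c = snd c ` fst c"

definition is_chart :: "('m::topological_space, 'd::finite) chart \<Rightarrow> bool" where
  "is_chart c \<longleftrightarrow> open (fst c) \<and> open (chart_image c) \<and>
     homeomorphism (fst c) (chart_image c) (snd c) (chart_inv c)"

text \<open>Any smooth atlas, not necessarily maximal, determines the smooth structure.\<close>

definition smooth_atlas ::
    "('m::{t2_space, second_countable_topology}, 'd::finite) chart set \<Rightarrow> bool" where
  "smooth_atlas A \<longleftrightarrow>
     (\<forall>c\<in>A. is_chart c) \<and> (\<Union>c\<in>A. fst c) = UNIV \<and>
     (\<forall>c\<in>A. \<forall>c'\<in>A. smooth_on (snd c ` (fst c \<inter> fst c')) (snd c' \<circ> chart_inv c))"

text \<open>A tangent vector at \<open>p\<close> is a class of pairs of a chart around \<open>p\<close> and a component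
  vector, pairs being identified by the Jacobian of the transition map. Each class has
  exactly one representative in the chart \<open>chart_at A p\<close> selected at \<open>p\<close>, and so the tangent
  space at \<open>p\<close> is represented by \<open>real ^ 'd\<close>, a vector standing for its components in
  \<open>chart_at A p\<close>. The maps \<open>to_chart A c p\<close> and \<open>from_chart A c p\<close> convert to and from
  components in another chart \<open>c\<close> around \<open>p\<close>. Since the selected chart may jump from point
  to point, smoothness of fields is always expressed by their components in a fixed chart.\<close>

definition chart_at :: "('m, 'd) chart set \<Rightarrow> 'm \<Rightarrow> ('m, 'd) chart" where
  "chart_at A p = (SOME c. c \<in> A \<and> p \<in> fst c)"

definition to_chart ::
    "('m, 'd::finite) chart set \<Rightarrow> ('m, 'd) chart \<Rightarrow> 'm \<Rightarrow> real ^ 'd \<Rightarrow> real ^ 'd" where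
  "to_chart A c p =
     frechet_derivative (snd c \<circ> chart_inv (chart_at A p)) (at (snd (chart_at A p) p))"

definition from_chart ::
    "('m, 'd::finite) chart set \<Rightarrow> ('m, 'd) chart \<Rightarrow> 'm \<Rightarrow> real ^ 'd \<Rightarrow> real ^ 'd" where
  "from_chart A c p =
     frechet_derivative (snd (chart_at A p) \<circ> chart_inv c) (at (snd c p))"

definition smooth_function :: "('m, 'd::finite) chart set \<Rightarrow> ('m \<Rightarrow> real) \<Rightarrow> bool" where
  "smooth_function A h \<longleftrightarrow> (\<forall>c\<in>A. smooth_on (chart_image c) (h \<circ> chart_inv c))"

definition differentiable_function :: "('m, 'd::finite) chart set \<Rightarrow> ('m \<Rightarrow> real) \<Rightarrow> bool" where
  "differentiable_function A h \<longleftrightarrow>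
     (\<forall>c\<in>A. \<forall>x\<in>chart_image c. (h \<circ> chart_inv c) differentiable (at x))"

definition vector_field :: "('m, 'd::finite) chart set \<Rightarrow> ('m, 'd) vfield \<Rightarrow> bool" where
  "vector_field A X \<longleftrightarrow>
     (\<forall>c\<in>A. smooth_on (chart_image c)
        (\<lambda>x. to_chart A c (chart_inv c x) (X (chart_inv c x))))"

definition one_form :: "('m, 'd::finite) chart set \<Rightarrow> ('m, 'd) covector_field \<Rightarrow> bool" where
  "one_form A \<omega> \<longleftrightarrow> (\<forall>p. linear (\<omega> p)) \<and>
     (\<forall>c\<in>A. \<forall>v. smooth_on (chart_image c)
        (\<lambda>x. \<omega> (chart_inv c x) (from_chart A c (chart_inv c x) v)))"

definition tangent_endomorphism ::
    "('m, 'd::finite) chart set \<Rightarrow> ('m, 'd) endo_field \<Rightarrow> bool" where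
  "tangent_endomorphism A \<phi> \<longleftrightarrow> (\<forall>p. linear (\<phi> p)) \<and>
     (\<forall>c\<in>A. \<forall>v. smooth_on (chart_image c)
        (\<lambda>x. to_chart A c (chart_inv c x)
               (\<phi> (chart_inv c x) (from_chart A c (chart_inv c x) v))))"

definition bilinear_tensor ::
    "('m, 'd::finite) chart set \<Rightarrow> ('m, 'd) bilinear_field \<Rightarrow> bool" where
  "bilinear_tensor A T \<longleftrightarrow> (\<forall>p. bilinear (T p)) \<and>
     (\<forall>c\<in>A. \<forall>v w. smooth_on (chart_image c)
        (\<lambda>x. T (chart_inv c x) (from_chart A c (chart_inv c x) v)
                               (from_chart A c (chart_inv c x) w)))"

text \<open>\<open>deriv_along A X h p\<close> is \<open>X(h) = dh(X)\<close> at \<open>p\<close>.\<close>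

definition deriv_along ::
    "('m, 'd::finite) chart set \<Rightarrow> ('m, 'd) vfield \<Rightarrow> ('m \<Rightarrow> real) \<Rightarrow> 'm \<Rightarrow> real" where
  "deriv_along A X h p =
     frechet_derivative (h \<circ> chart_inv (chart_at A p)) (at (snd (chart_at A p) p)) (X p)"

text \<open>In coordinates \<open>[X, Y]^i = X^j \<partial>_j Y^i - Y^j \<partial>_j X^i\<close>, computed at \<open>p\<close> in \<open>chart_at A p\<close>.\<close>

definition lie_bracket ::
    "('m, 'd::finite) chart set \<Rightarrow> ('m, 'd) vfield \<Rightarrow> ('m, 'd) vfield \<Rightarrow> ('m, 'd) vfield" where
  "lie_bracket A X Y p =
     (let c = chart_at A p;
          comps = (\<lambda>Z x. to_chart A c (chart_inv c x) (Z (chart_inv c x)))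
      in frechet_derivative (comps Y) (at (snd c p)) (X p)
         - frechet_derivative (comps X) (at (snd c p)) (Y p))"


section \<open>Pseudo-Riemannian geometry\<close>

definition has_signature ::
    "(real ^ 'd::finite \<Rightarrow> real ^ 'd \<Rightarrow> real) \<Rightarrow> nat \<Rightarrow> nat \<Rightarrow> bool" where
  "has_signature B r s \<longleftrightarrow>
     (\<exists>(e :: 'd \<Rightarrow> real ^ 'd) P. card P = r \<and> card (- P) = s \<and>
        (\<forall>i j. B (e i) (e j) = (if i = j then (if i \<in> P then 1 else -1) else 0)))"

definition pseudo_riemannian_metric ::
    "('m, 'd::finite) chart set \<Rightarrow> ('m, 'd) bilinear_field \<Rightarrow> nat \<Rightarrow> nat \<Rightarrow> bool" where
  "pseudo_riemannian_metric A g r s \<longleftrightarrow> bilinear_tensor A g \<and>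
     (\<forall>p u v. g p u v = g p v u) \<and> (\<forall>p. has_signature (g p) r s)"

text \<open>A connection is an operator on smooth vector fields; it is unconstrained on other
  arguments.\<close>

type_synonym ('m, 'd) connection = "('m, 'd) vfield \<Rightarrow> ('m, 'd) vfield \<Rightarrow> ('m, 'd) vfield"

definition affine_connection ::
    "('m, 'd::finite) chart set \<Rightarrow> ('m, 'd) connection \<Rightarrow> bool" where
  "affine_connection A nabla \<longleftrightarrow>
     (\<forall>X Y. vector_field A X \<and> vector_field A Y \<longrightarrow> vector_field A (nabla X Y)) \<and>
     (\<forall>X Y Z p. vector_field A X \<and> vector_field A Y \<and> vector_field A Z \<longrightarrow>
        nabla (\<lambda>q. X q + Y q) Z p = nabla X Z p + nabla Y Z p \<and>
        nabla X (\<lambda>q. Y q + Z q) p = nabla X Y p + nabla X Z p) \<and>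
     (\<forall>h X Y p. smooth_function A h \<and> vector_field A X \<and> vector_field A Y \<longrightarrow>
        nabla (\<lambda>q. h q *\<^sub>R X q) Y p = h p *\<^sub>R nabla X Y p \<and>
        nabla X (\<lambda>q. h q *\<^sub>R Y q) p = h p *\<^sub>R nabla X Y p + deriv_along A X h p *\<^sub>R Y p)"

definition levi_civita_connection ::
    "('m, 'd::finite) chart set \<Rightarrow> ('m, 'd) bilinear_field \<Rightarrow> ('m, 'd) connection \<Rightarrow> bool" where
  "levi_civita_connection A g nabla \<longleftrightarrow> affine_connection A nabla \<and>
     (\<forall>X Y p. vector_field A X \<and> vector_field A Y \<longrightarrow>
        nabla X Y p - nabla Y X p = lie_bracket A X Y p) \<and>
     (\<forall>X Y Z p. vector_field A X \<and> vector_field A Y \<and> vector_field A Z \<longrightarrow>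
        deriv_along A X (\<lambda>q. g q (Y q) (Z q)) p
          = g p (nabla X Y p) (Z p) + g p (Y p) (nabla X Z p))"

definition curvature ::
    "('m, 'd::finite) chart set \<Rightarrow> ('m, 'd) connection \<Rightarrow>
     ('m, 'd) vfield \<Rightarrow> ('m, 'd) vfield \<Rightarrow> ('m, 'd) vfield \<Rightarrow> ('m, 'd) vfield" where
  "curvature A nabla X Y Z p =
     nabla X (nabla Y Z) p - nabla Y (nabla X Z) p - nabla (lie_bracket A X Y) Z p"

text \<open>Some global smooth vector field with value \<open>v\<close> at \<open>p\<close>. The value at \<open>p\<close> of a tensorial
  expression such as the curvature does not depend on the choice of the extension.\<close>

definition extend_vector ::
    "('m, 'd::finite) chart set \<Rightarrow> 'm \<Rightarrow> real ^ 'd \<Rightarrow> ('m, 'd) vfield" where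
  "extend_vector A p v = (SOME X. vector_field A X \<and> X p = v)"

text \<open>Ricci tensor, \<open>\<rho>(Y, Z) = tr (x \<mapsto> R(x, Y)Z)\<close>.\<close>

definition ricci ::
    "('m, 'd::finite) chart set \<Rightarrow> ('m, 'd) connection \<Rightarrow>
     ('m, 'd) vfield \<Rightarrow> ('m, 'd) vfield \<Rightarrow> 'm \<Rightarrow> real" where
  "ricci A nabla Y Z p =
     trace (matrix (\<lambda>v. curvature A nabla (extend_vector A p v) Y Z p))"

definition lie_derivative_metric ::
    "('m, 'd::finite) chart set \<Rightarrow> ('m, 'd) bilinear_field \<Rightarrow> ('m, 'd) vfield \<Rightarrow>
     ('m, 'd) vfield \<Rightarrow> ('m, 'd) vfield \<Rightarrow> 'm \<Rightarrow> real" where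
  "lie_derivative_metric A g V X Y p =
     deriv_along A V (\<lambda>q. g q (X q) (Y q)) p
     - g p (lie_bracket A V X p) (Y p) - g p (X p) (lie_bracket A V Y p)"


section \<open>Almost contact B-metric manifolds\<close>

definition almost_contact_B_metric_manifold ::
    "nat \<Rightarrow> ('m::{t2_space, second_countable_topology}, 'd::finite) chart set \<Rightarrow>
     ('m, 'd) endo_field \<Rightarrow> ('m, 'd) vfield \<Rightarrow> ('m, 'd) covector_field \<Rightarrow>
     ('m, 'd) bilinear_field \<Rightarrow> bool" where
  "almost_contact_B_metric_manifold n A \<phi> \<xi> \<eta> g \<longleftrightarrow>
     n \<ge> 1 \<and> CARD('d) = 2 * n + 1 \<and> smooth_atlas A \<and>
     tangent_endomorphism A \<phi> \<and> vector_field A \<xi> \<and> one_form A \<eta> \<and>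
     pseudo_riemannian_metric A g (n + 1) n \<and>
     (\<forall>p. \<phi> p (\<xi> p) = 0) \<and>
     (\<forall>p x. \<phi> p (\<phi> p x) = - x + \<eta> p x *\<^sub>R \<xi> p) \<and>
     (\<forall>p x. \<eta> p (\<phi> p x) = 0) \<and>
     (\<forall>p. \<eta> p (\<xi> p) = 1) \<and>
     (\<forall>p x y. g p (\<phi> p x) (\<phi> p y) = - g p x y + \<eta> p x * \<eta> p y)"

definition associated_metric ::
    "('m, 'd) endo_field \<Rightarrow> ('m, 'd) covector_field \<Rightarrow> ('m, 'd) bilinear_field \<Rightarrow>
     ('m, 'd) bilinear_field" where
  "associated_metric \<phi> \<eta> g p x y = g p x (\<phi> p y) + \<eta> p x * \<eta> p y"

definition torse_forming ::
    "('m, 'd::finite) chart set \<Rightarrow> ('m, 'd) connection \<Rightarrow> ('m, 'd) vfield \<Rightarrow>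
     ('m \<Rightarrow> real) \<Rightarrow> bool" where
  "torse_forming A nabla \<theta> f \<longleftrightarrow>
     vector_field A \<theta> \<and> differentiable_function A f \<and> \<not> (\<forall>p. f p = 0) \<and>
     (\<exists>\<gamma>. one_form A \<gamma> \<and>
        (\<forall>X p. vector_field A X \<longrightarrow>
           nabla X \<theta> p = f p *\<^sub>R X p + \<gamma> p (X p) *\<^sub>R \<theta> p))"

text \<open>In the following two definitions an equality of \<open>(0,2)\<close>-tensors is expressed as equality of
  the values on all smooth vector fields.\<close>

definition almost_Ricci_like_soliton ::
    "('m, 'd::finite) chart set \<Rightarrow> ('m, 'd) endo_field \<Rightarrow> ('m, 'd) covector_field \<Rightarrow>
     ('m, 'd) bilinear_field \<Rightarrow> ('m, 'd) connection \<Rightarrow> ('m, 'd) vfield \<Rightarrow>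
     ('m \<Rightarrow> real) \<Rightarrow> ('m \<Rightarrow> real) \<Rightarrow> ('m \<Rightarrow> real) \<Rightarrow> bool" where
  "almost_Ricci_like_soliton A \<phi> \<eta> g nabla \<theta> lam mu nu \<longleftrightarrow>
     (\<forall>X Y p. vector_field A X \<and> vector_field A Y \<longrightarrow>
        1 / 2 * lie_derivative_metric A g \<theta> X Y p + ricci A nabla X Y p
        + lam p * g p (X p) (Y p) + mu p * associated_metric \<phi> \<eta> g p (X p) (Y p)
        + nu p * (\<eta> p (X p) * \<eta> p (Y p)) = 0)"

definition almost_Einstein_like ::
    "('m, 'd::finite) chart set \<Rightarrow> ('m, 'd) endo_field \<Rightarrow> ('m, 'd) covector_field \<Rightarrow>
     ('m, 'd) bilinear_field \<Rightarrow> ('m, 'd) connection \<Rightarrow>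
     ('m \<Rightarrow> real) \<Rightarrow> ('m \<Rightarrow> real) \<Rightarrow> ('m \<Rightarrow> real) \<Rightarrow> bool" where
  "almost_Einstein_like A \<phi> \<eta> g nabla a b c \<longleftrightarrow>
     (\<forall>X Y p. vector_field A X \<and> vector_field A Y \<longrightarrow>
        ricci A nabla X Y p
        = a p * g p (X p) (Y p) + b p * associated_metric \<phi> \<eta> g p (X p) (Y p)
          + c p * (\<eta> p (X p) * \<eta> p (Y p)))"

end

theory Submission
  imports Defs
begin

text \<open>
  The two tensor equations in the theorem differ only by the term
  \<open>1/2 L\<^sub>\<theta> g\<close>, so the Ricci tensor is merely carried along, and everything rests on
  \<open>1/2 L\<^sub>\<theta> g = f (g - \<eta> \<otimes> \<eta>)\<close>
  (\<open>lie_derivative_metric_vertical_torse_forming\<close>).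

  For the Levi-Civita connection, \<open>(L\<^sub>\<theta> g)(X, Y) = g(\<nabla>\<^sub>X \<theta>, Y) + g(X, \<nabla>\<^sub>Y \<theta>)\<close>. Inserting
  \<open>\<nabla>\<^sub>X \<theta> = f X + \<gamma>(X) \<theta>\<close>, and using that \<open>\<eta>\<close> is \<open>g\<close>-dual to \<open>\<xi>\<close>, so that
  \<open>g(\<theta>, Y) = k \<eta>(Y)\<close>, this becomes
  \<open>2 f g(X, Y) + k \<gamma>(X) \<eta>(Y) + k \<gamma>(Y) \<eta>(X)\<close>. Finally the generating form is determined:
  \<open>g(\<theta>, \<theta>) = k\<^sup>2\<close> is constant, hence \<open>\<nabla>\<^sub>X \<theta>\<close> is orthogonal to \<open>\<theta>\<close>, which reads
  \<open>k f \<eta>(X) + k\<^sup>2 \<gamma>(X) = 0\<close>, that is \<open>k \<gamma> = - f \<eta>\<close>. The relations between the two triples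
  of functions then turn one equation into the other point by point.
\<close>

lemma deriv_along_const: "deriv_along A X (\<lambda>q. r) p = 0"
  by (simp add: deriv_along_def o_def)

text \<open>Metric compatibility expands \<open>V(g(X, Y))\<close>, and vanishing torsion replaces \<open>[V, X]\<close> by
  \<open>\<nabla>\<^sub>V X - \<nabla>\<^sub>X V\<close>; all derivatives in the direction of \<open>V\<close> cancel.\<close>

lemma lie_derivative_metric_levi_civita:
  assumes lc: "levi_civita_connection A g nabla" and bil: "bilinear (g p)"
    and V: "vector_field A V" and X: "vector_field A X" and Y: "vector_field A Y"
  shows "lie_derivative_metric A g V X Y p = g p (nabla X V p) (Y p) + g p (X p) (nabla Y V p)"
proof -
  have "lie_bracket A V Z p = nabla V Z p - nabla Z V p" if "vector_field A Z" for Z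
    using lc V that unfolding levi_civita_connection_def by metis
  moreover have "deriv_along A V (\<lambda>q. g q (X q) (Y q)) p
      = g p (nabla V X p) (Y p) + g p (X p) (nabla V Y p)"
    using lc V X Y unfolding levi_civita_connection_def by blast
  ultimately show ?thesis
    using X Y by (simp add: lie_derivative_metric_def bilinear_lsub[OF bil] bilinear_rsub[OF bil])
qed

text \<open>A vector field of constant length is orthogonal to its covariant derivatives.\<close>

lemma nabla_orthogonal_of_constant_length:
  assumes lc: "levi_civita_connection A g nabla" and sym: "\<And>q u v. g q u v = g q v u"
    and V: "vector_field A V" and X: "vector_field A X"
    and len: "\<And>q. g q (V q) (V q) = r"
  shows "g p (nabla X V p) (V p) = 0"
proof -
  have "deriv_along A X (\<lambda>q. g q (V q) (V q)) p
      = g p (nabla X V p) (V p) + g p (V p) (nabla X V p)"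
    using lc V X unfolding levi_civita_connection_def by blast
  then show ?thesis
    using sym[of p "V p" "nabla X V p"] by (simp add: len deriv_along_const)
qed

lemma bilinear_metric:
  assumes "almost_contact_B_metric_manifold n A \<phi> \<xi> \<eta> g"
  shows "bilinear (g p)"
  using assms unfolding almost_contact_B_metric_manifold_def
    pseudo_riemannian_metric_def bilinear_tensor_def by blast

lemma symmetric_metric:
  assumes "almost_contact_B_metric_manifold n A \<phi> \<xi> \<eta> g"
  shows "g p u v = g p v u"
  using assms unfolding almost_contact_B_metric_manifold_def
    pseudo_riemannian_metric_def by blast

text \<open>Insert \<open>y = \<xi>\<close> into the B-metric identity: its left side vanishes as \<open>\<phi> \<xi> = 0\<close>.\<close>

lemma metric_reeb:
  assumes M: "almost_contact_B_metric_manifold n A \<phi> \<xi> \<eta> g"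
  shows "g p x (\<xi> p) = \<eta> p x"
proof -
  have "g p (\<phi> p x) (\<phi> p (\<xi> p)) = - g p x (\<xi> p) + \<eta> p x * \<eta> p (\<xi> p)"
    and "\<phi> p (\<xi> p) = 0" and "\<eta> p (\<xi> p) = 1"
    using M unfolding almost_contact_B_metric_manifold_def by blast+
  then show ?thesis
    by (simp add: bilinear_rzero[OF bilinear_metric[OF M]])
qed

lemma metric_vertical:
  assumes M: "almost_contact_B_metric_manifold n A \<phi> \<xi> \<eta> g"
    and vert: "\<theta> p = k *\<^sub>R \<xi> p"
  shows "g p x (\<theta> p) = k * \<eta> p x"
  by (simp add: vert bilinear_rmul[OF bilinear_metric[OF M]] metric_reeb[OF M])

text \<open>For \<open>\<theta> = k \<xi>\<close> the length \<open>g(\<theta>, \<theta>) = k\<^sup>2\<close> is constant, and orthogonality of \<open>\<nabla>\<^sub>X \<theta>\<close> to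
  \<open>\<theta>\<close> leaves no freedom in the generating form.\<close>

lemma generating_form_vertical:
  assumes M: "almost_contact_B_metric_manifold n A \<phi> \<xi> \<eta> g"
    and lc: "levi_civita_connection A g nabla"
    and k: "k \<noteq> 0" and vert: "\<And>q. \<theta> q = k *\<^sub>R \<xi> q"
    and \<theta>: "vector_field A \<theta>" and X: "vector_field A X"
    and nabla\<theta>: "nabla X \<theta> p = s *\<^sub>R X p + t *\<^sub>R \<theta> p"
  shows "k * t = - s * \<eta> p (X p)"
proof -
  note dual = metric_vertical[where \<theta> = \<theta> and k = k, OF M vert]
  have lin: "linear (\<eta> q)" and \<eta>\<xi>: "\<eta> q (\<xi> q) = 1" for q
    using M unfolding almost_contact_B_metric_manifold_def one_form_def by blast+
  have \<eta>\<theta>: "\<eta> q (\<theta> q) = k" for q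
    by (simp add: vert linear_cmul[OF lin] \<eta>\<xi>)
  have len: "g q (\<theta> q) (\<theta> q) = k * k" for q
    by (simp add: dual \<eta>\<theta>)
  have "0 = g p (nabla X \<theta> p) (\<theta> p)"
    using nabla_orthogonal_of_constant_length[OF lc symmetric_metric[OF M] \<theta> X len] by simp
  also have "\<dots> = s * (k * \<eta> p (X p)) + t * (k * k)"
    by (simp add: nabla\<theta> dual linear_add[OF lin] linear_cmul[OF lin] \<eta>\<theta> algebra_simps)
  also have "\<dots> = k * (k * t + s * \<eta> p (X p))"
    by (simp add: algebra_simps)
  finally show ?thesis
    using k by simp
qed

text \<open>Each of the two summands \<open>g(\<nabla>\<^sub>X \<theta>, Y)\<close> and \<open>g(X, \<nabla>\<^sub>Y \<theta>)\<close> equals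
  \<open>f (g(X, Y) - \<eta>(X) \<eta>(Y))\<close>: up to the factor \<open>f\<close>, covariant differentiation of \<open>\<theta>\<close> is the
  projection along \<open>\<xi>\<close> to the contact distribution.\<close>

lemma lie_derivative_metric_vertical_torse_forming:
  assumes M: "almost_contact_B_metric_manifold n A \<phi> \<xi> \<eta> g"
    and lc: "levi_civita_connection A g nabla"
    and k: "k \<noteq> 0" and vert: "\<And>q. \<theta> q = k *\<^sub>R \<xi> q"
    and torse: "torse_forming A nabla \<theta> f"
    and X: "vector_field A X" and Y: "vector_field A Y"
  shows "1 / 2 * lie_derivative_metric A g \<theta> X Y p
    = f p * (g p (X p) (Y p) - \<eta> p (X p) * \<eta> p (Y p))"
proof -
  note bil = bilinear_metric[OF M] and sym = symmetric_metric[OF M]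
    and dual = metric_vertical[where \<theta> = \<theta> and k = k, OF M vert]
  obtain \<gamma> where \<theta>: "vector_field A \<theta>"
    and nabla\<theta>: "\<And>Z. vector_field A Z \<Longrightarrow> nabla Z \<theta> p = f p *\<^sub>R Z p + \<gamma> p (Z p) *\<^sub>R \<theta> p"
    using torse unfolding torse_forming_def by blast
  have half: "g p (nabla Z \<theta> p) w = f p * (g p (Z p) w - \<eta> p (Z p) * \<eta> p w)"
    if Z: "vector_field A Z" for Z w
  proof -
    have "g p (nabla Z \<theta> p) w = f p * g p (Z p) w + (k * \<gamma> p (Z p)) * \<eta> p w"
      by (simp add: nabla\<theta>[OF Z] bilinear_ladd[OF bil] bilinear_lmul[OF bil]
          sym[of p "\<theta> p" w] dual)
    then show ?thesis
      by (simp add: generating_form_vertical[OF M lc k vert \<theta> Z nabla\<theta>[OF Z]] algebra_simps)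
  qed
  have "g p (X p) (nabla Y \<theta> p) = f p * (g p (X p) (Y p) - \<eta> p (X p) * \<eta> p (Y p))"
    using half[OF Y, of "X p"] sym[of p "X p"] by (simp add: mult.commute)
  then show ?thesis
    by (simp add: lie_derivative_metric_levi_civita[OF lc bil \<theta> X Y] half[OF X])
qed

theorem theorem3p2:
  fixes n :: nat
    and A :: "('m::{t2_space, second_countable_topology}, 'd::finite) chart set"
    and \<phi> :: "('m, 'd) endo_field"
    and \<xi> \<theta> :: "('m, 'd) vfield"
    and \<eta> :: "('m, 'd) covector_field"
    and g :: "('m, 'd) bilinear_field"
    and nabla :: "('m, 'd) connection"
    and k :: real
    and f a b c lam mu nu :: "'m \<Rightarrow> real"
  assumes "almost_contact_B_metric_manifold n A \<phi> \<xi> \<eta> g"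
    and "levi_civita_connection A g nabla"
    and "k \<noteq> 0" and "\<forall>p. \<theta> p = k *\<^sub>R \<xi> p"
    and "torse_forming A nabla \<theta> f"
    and "\<forall>p. a p + lam p + f p = 0"
    and "\<forall>p. b p + mu p = 0"
    and "\<forall>p. c p + nu p - f p = 0"
    and "\<forall>p. lam p + mu p + nu p = - a p - b p - c p"
    and "\<forall>p. - a p - b p - c p
              = 2 * real n / k\<^sup>2 * (k * deriv_along A \<xi> f p + (f p)\<^sup>2)"
  shows "almost_Ricci_like_soliton A \<phi> \<eta> g nabla \<theta> lam mu nu
         \<longleftrightarrow> almost_Einstein_like A \<phi> \<eta> g nabla a b c"
proof -
  have "1 / 2 * lie_derivative_metric A g \<theta> X Y p + ricci A nabla X Y p
      + lam p * g p (X p) (Y p) + mu p * associated_metric \<phi> \<eta> g p (X p) (Y p)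
      + nu p * (\<eta> p (X p) * \<eta> p (Y p)) = 0
    \<longleftrightarrow> ricci A nabla X Y p
      = a p * g p (X p) (Y p) + b p * associated_metric \<phi> \<eta> g p (X p) (Y p)
        + c p * (\<eta> p (X p) * \<eta> p (Y p))"
    if XY: "vector_field A X" "vector_field A Y" for X Y p
  proof -
    have lie: "1 / 2 * lie_derivative_metric A g \<theta> X Y p
        = f p * (g p (X p) (Y p) - \<eta> p (X p) * \<eta> p (Y p))"
      using lie_derivative_metric_vertical_torse_forming[OF assms(1-3) _ assms(5) XY] assms(4)
      by blast
    have "lam p = - a p - f p" and "mu p = - b p" and "nu p = f p - c p"
      using assms(6-8)[rule_format, of p] by linarith+
    then show ?thesis
      unfolding lie by (simp only:) (auto simp: algebra_simps)
  qed
  then show ?thesis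
    unfolding almost_Ricci_like_soliton_def almost_Einstein_like_def by blast
qed

end
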